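(* Let $n\geq 2$ and suppose a deck of $n$ cards is given one single-shelf shuffle, and the player is given complete feedback. Suppose the player uses the following strategy: in position $1$, guess card $1$; in every position $j+1\geq 2$ such that neither card $n-1$ nor card $n$ has been shown in positions $1,\dots,j$, guess the card $r_j+1$, where $r_j$ is the card shown in position $j$; once a card of $\{n-1,n\}$ has first been shown, guess the remaining (not yet shown) cards in descending order. Then the expected number of correct guesses is $3n/4$.
   Context: Single-shelf shuffle: a deck of cards is initially labeled $1,2,\dots,n$ from top to bottom. Cards are drawn one at a time from the bottom of the deck (card $n$ first, card $1$ last) and placed in a pile; each drawn card is placed, independently, on the top or at the bottom of the existing pile with probability $1/2$ each. The final pile is the shuffled deck; position $1$ is its top, and $r_j$ denotes the card in position $j$. Complete feedback: the player guesses the cards in positions $1,2,\dots,n$ in order, and after each guess the card in that position is turned face up. The guess in position $j$ is correct if it equals $r_j$. *)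

theory Defs
  imports "HOL-Probability.Probability"
begin

text \<open>
  A pile or deck is a list of cards whose head is the top card. The first argument below lists
  the cards still to be placed, in the order in which they are drawn.
\<close>

primrec place_cards :: "nat list \<Rightarrow> nat list \<Rightarrow> nat list pmf" where
  "place_cards [] pile = return_pmf pile"
| "place_cards (c # cs) pile =
     bind_pmf (bernoulli_pmf (1/2))
       (\<lambda>on_top. place_cards cs (if on_top then c # pile else pile @ [c]))"

definition shelf_shuffle :: "nat \<Rightarrow> nat list pmf" where
  "shelf_shuffle n = place_cards (rev [1..<Suc n]) []"

text \<open>
  With complete feedback, a strategy maps the list of cards shown so far (position 1 first)
  to the next guess. Position \<open>j + 1\<close> is index \<open>j\<close> of the deck, and \<open>take j deck\<close>
  is what has been shown before the guess in that position.
\<close>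

type_synonym strategy = "nat list \<Rightarrow> nat"

definition correct_guesses :: "strategy \<Rightarrow> nat list \<Rightarrow> nat" where
  "correct_guesses \<sigma> deck = card {j. j < length deck \<and> \<sigma> (take j deck) = deck ! j}"

text \<open>
  Guessing the remaining cards in descending order means always guessing the largest card not
  yet shown. The maximum is only relevant for fewer than \<open>n\<close> shown cards, where it is taken
  over a nonempty set.
\<close>

definition shelf_strategy :: "nat \<Rightarrow> strategy" where
  "shelf_strategy n shown =
     (if shown = [] then 1
      else if n - 1 \<notin> set shown \<and> n \<notin> set shown then last shown + 1
      else Max ({1..n} - set shown))"

end

theory Submission
  imports Defs
begin

text \<open>
  Let \<open>V m\<close> be the score on a pile of the cards \<open>m + 1, \<dots>, n\<close> when the first guess is
  \<open>m + 1\<close>. Putting card \<open>m\<close> on top gives \<open>V (m - 1) = V m + 1\<close>, since the guess \<open>m\<close> is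
  correct and is followed by the guess \<open>m + 1\<close>. Putting it at the bottom gives
  \<open>V (m - 1) = V m + 1 - h\<close>, where \<open>h\<close> indicates that \<open>m + 1\<close> was on top: the bottom card is
  guessed correctly, but the first guess \<open>m\<close> is now wrong. So each card gains \<open>1 - h / 2\<close> on
  average, and \<open>h\<close> has mean \<open>1 / 2\<close> except at card \<open>n - 1\<close>, where it is \<open>1\<close>. The total is
  \<open>1 + 1 / 2 + 3 (n - 2) / 4 = 3 n / 4\<close>.
\<close>

lemma correct_guesses_eq_sum:
  "correct_guesses \<sigma> deck = (\<Sum>j<length deck. of_bool (\<sigma> (take j deck) = deck ! j))"
proof -
  have "{j. j < length deck \<and> \<sigma> (take j deck) = deck ! j}
      = {..<length deck} \<inter> {j. \<sigma> (take j deck) = deck ! j}"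
    by auto
  then show ?thesis
    by (simp add: correct_guesses_def)
qed

lemma correct_guesses_Cons:
  "correct_guesses \<sigma> (c # deck) =
     of_bool (\<sigma> [] = c) + correct_guesses (\<lambda>shown. \<sigma> (c # shown)) deck"
  by (simp add: correct_guesses_eq_sum sum.lessThan_Suc_shift del: sum.lessThan_Suc)

lemma correct_guesses_snoc:
  "correct_guesses \<sigma> (deck @ [c]) = correct_guesses \<sigma> deck + of_bool (\<sigma> deck = c)"
  by (simp add: correct_guesses_eq_sum nth_append)

lemma correct_guesses_cong:
  assumes "\<And>j. j < length deck \<Longrightarrow> \<sigma> (take j deck) = \<tau> (take j deck)"
  shows "correct_guesses \<sigma> deck = correct_guesses \<tau> deck"
  by (simp add: correct_guesses_eq_sum assms)

text \<open>Counting: a distinct list has as many elements as positions. This keeps the set of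
  unseen cards, over which \<open>Max\<close> is taken, nonempty.\<close>

lemma set_take_psubset:
  assumes "distinct xs" "j < length xs"
  shows "set (take j xs) \<subset> set xs"
proof -
  have "card (set (take j xs)) < card (set xs)"
    using assms by (simp add: distinct_card)
  then show ?thesis
    by (metis psubsetI set_take_subset less_irrefl)
qed

lemma Max_insert_less:
  fixes m :: "'a::linorder"
  assumes "finite A" "A \<noteq> {}" "\<And>x. x \<in> A \<Longrightarrow> m < x"
  shows "Max (insert m A) = Max A"
  using assms by (metis Max_in Max_insert max.absorb2 less_imp_le)

lemma finite_set_pmf_place_cards: "finite (set_pmf (place_cards cs pile))"
  by (induction cs arbitrary: pile) auto

lemma expectation_place_cards_Cons:
  fixes f :: "nat list \<Rightarrow> real"
  shows "measure_pmf.expectation (place_cards (c # cs) pile) f =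
    (measure_pmf.expectation (place_cards cs (c # pile)) f
      + measure_pmf.expectation (place_cards cs (pile @ [c])) f) / 2"
proof -
  have "measure_pmf.expectation (place_cards (c # cs) pile) f =
    (\<Sum>b\<in>UNIV. pmf (bernoulli_pmf (1/2)) b *\<^sub>R
       measure_pmf.expectation (place_cards cs (if b then c # pile else pile @ [c])) f)"
    unfolding place_cards.simps
    by (rule pmf_expectation_bind) (simp_all add: finite_set_pmf_place_cards)
  then show ?thesis
    by (simp add: UNIV_bool field_simps)
qed

text \<open>Lets a partial pile of the cards \<open>m + 1\<close> to \<open>n\<close> be scored as a
  deck of its own, so that the score can be followed card by card.\<close>

definition shelf_strategy_above :: "nat \<Rightarrow> nat \<Rightarrow> strategy" where
  "shelf_strategy_above m n shown =
     (if shown = [] then Suc m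
      else if n - 1 \<notin> set shown \<and> n \<notin> set shown then last shown + 1
      else Max ({m<..n} - set shown))"

lemma shelf_strategy_above_0: "shelf_strategy_above 0 n = shelf_strategy n"
proof -
  have "{0<..n} = {1..n}" by auto
  then show ?thesis
    by (simp add: fun_eq_iff shelf_strategy_above_def shelf_strategy_def)
qed

context
  fixes m n :: nat and pile :: "nat list"
  assumes less: "Suc m < n"
    and dist: "distinct pile"
    and set_pile: "set pile = {Suc m<..n}"
begin

lemma correct_guesses_above_top:
  "correct_guesses (shelf_strategy_above m n) (Suc m # pile) =
     Suc (correct_guesses (shelf_strategy_above (Suc m) n) pile)"
proof -
  have "shelf_strategy_above m n (Suc m # take j pile) =
        shelf_strategy_above (Suc m) n (take j pile)" if "j < length pile" for j
  proof -
    have *: "{m<..n} - insert (Suc m) S = {Suc m<..n} - S" for S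
      by auto
    \<comment> \<open>If the new card is \<open>n - 1\<close>, showing it already starts the
      descending phase. The pile is then just \<open>[n]\<close>, so \<open>j = 0\<close>, and the
      largest unseen card \<open>n\<close> is also the successor guess.\<close>
    have eq: "{Suc m<..n} = {n}" if "Suc m = n - 1"
      using that less by auto
    have "take j pile = []" if "Suc m = n - 1"
      using set_take_psubset[OF dist \<open>j < length pile\<close>] that
      unfolding set_pile eq[OF that] by (metis subset_singletonD psubset_eq set_empty)
    then show ?thesis
      using less eq by (auto simp: shelf_strategy_above_def *)
  qed
  then have "correct_guesses (\<lambda>shown. shelf_strategy_above m n (Suc m # shown)) pile =
      correct_guesses (shelf_strategy_above (Suc m) n) pile"
    by (rule correct_guesses_cong)
  then show ?thesis
    by (simp add: correct_guesses_Cons shelf_strategy_above_def[of m n "[]"])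
qed

lemma correct_guesses_above_bottom:
  "correct_guesses (shelf_strategy_above m n) (pile @ [Suc m]) + of_bool (hd pile = Suc (Suc m)) =
     Suc (correct_guesses (shelf_strategy_above (Suc m) n) pile)"
proof -
  have agree: "shelf_strategy_above m n (take j pile) =
        shelf_strategy_above (Suc m) n (take j pile)" if "j < length pile" "j \<noteq> 0" for j
  proof -
    have sub: "set (take j pile) \<subset> {Suc m<..n}"
      using set_take_psubset[OF dist that(1)] set_pile by simp
    \<comment> \<open>The extra unseen card \<open>Suc m\<close> lies below all others, and another
      one is still unseen, so the maximum does not change.\<close>
    then have "{m<..n} - set (take j pile) = insert (Suc m) ({Suc m<..n} - set (take j pile))"
      using less by auto
    also have "Max \<dots> = Max ({Suc m<..n} - set (take j pile))"
      using sub by (intro Max_insert_less) auto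
    finally have "Max ({m<..n} - set (take j pile)) = Max ({Suc m<..n} - set (take j pile))" .
    moreover have "take j pile \<noteq> []"
      using that by auto
    ultimately show ?thesis
      by (simp only: shelf_strategy_above_def if_False)
  qed
  have "n \<in> set pile" "{m<..n} - set pile = {Suc m}"
    using less set_pile by auto
  then have last: "shelf_strategy_above m n pile = Suc m"
    by (auto simp: shelf_strategy_above_def)
  obtain c cs where pile: "pile = c # cs"
    using \<open>n \<in> set pile\<close> by (cases pile) auto
  have "c \<noteq> Suc m"
    using set_pile pile by auto
  have tail: "correct_guesses (\<lambda>shown. shelf_strategy_above m n (c # shown)) cs =
      correct_guesses (\<lambda>shown. shelf_strategy_above (Suc m) n (c # shown)) cs"
  proof (rule correct_guesses_cong)
    fix j assume "j < length cs"
    then show "shelf_strategy_above m n (c # take j cs) =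
        shelf_strategy_above (Suc m) n (c # take j cs)"
      using agree[of "Suc j"] pile by simp
  qed
  \<comment> \<open>Within the old pile only the first guess differs: \<open>Suc m\<close> always
    misses there, while \<open>Suc (Suc m)\<close> hits exactly when it is on top.\<close>
  have "shelf_strategy_above k n [] = Suc k" for k
    by (simp add: shelf_strategy_above_def)
  moreover have "correct_guesses (shelf_strategy_above m n) (pile @ [Suc m]) =
      Suc (correct_guesses (shelf_strategy_above m n) pile)"
    by (simp add: correct_guesses_snoc last)
  ultimately show ?thesis
    using \<open>c \<noteq> Suc m\<close> tail unfolding pile by (auto simp: correct_guesses_Cons)
qed

end

text \<open>Induction on the number \<open>m\<close> of cards still to be placed. Each is credited
  \<open>3 / 4\<close>, the gain for a fair top card; only the next one, card \<open>m\<close>, sees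
  a known top card \<open>hd pile\<close>, and its true gain \<open>1 - h / 2\<close> exceeds
  \<open>3 / 4\<close> by the last summand.\<close>

lemma expectation_place_cards_shelf_strategy:
  assumes "m < n" "distinct pile" "set pile = {m<..n}"
  shows "measure_pmf.expectation (place_cards (rev [1..<Suc m]) pile)
           (\<lambda>deck. real (correct_guesses (shelf_strategy n) deck)) =
         real (correct_guesses (shelf_strategy_above m n) pile) + 3 * real m / 4
           + (if m = 0 then 0 else 1 / 4 - of_bool (hd pile = Suc m) / 2)"
  using assms
proof (induction m arbitrary: pile)
  case 0
  then show ?case
    by (simp add: shelf_strategy_above_0)
next
  case (Suc m)
  have rev_upt: "rev [1..<Suc (Suc m)] = Suc m # rev [1..<Suc m]"
    by simp
  have set_new: "insert (Suc m) (set pile) = {m<..n}"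
    using Suc.prems by auto
  have "pile \<noteq> []" "Suc m \<notin> set pile"
    using Suc.prems by auto
  then have "hd pile \<noteq> Suc m"
    by (metis hd_in_set)
  have hds: "hd (Suc m # pile) = Suc m" "hd (pile @ [Suc m]) \<noteq> Suc m"
    using \<open>pile \<noteq> []\<close> \<open>hd pile \<noteq> Suc m\<close> by simp_all
  \<comment> \<open>Now \<open>Suc m\<close> is on top, so the next card has correction
    \<open>1 / 4 - 1 / 2\<close>. At the bottom it leaves \<open>1 / 4\<close>, and the two cancel
    in the average.\<close>
  have top: "measure_pmf.expectation (place_cards (rev [1..<Suc m]) (Suc m # pile))
        (\<lambda>deck. real (correct_guesses (shelf_strategy n) deck)) =
      1 + real (correct_guesses (shelf_strategy_above (Suc m) n) pile) + 3 * real m / 4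
        + (if m = 0 then 0 else - 1 / 4)"
    using Suc.prems set_new \<open>Suc m \<notin> set pile\<close> hds
    by (subst Suc.IH) (simp_all add: correct_guesses_above_top)
  have bottom_score: "real (correct_guesses (shelf_strategy_above m n) (pile @ [Suc m])) =
      1 + real (correct_guesses (shelf_strategy_above (Suc m) n) pile)
        - of_bool (hd pile = Suc (Suc m))"
    using correct_guesses_above_bottom[OF Suc.prems] by (auto simp: of_bool_def split: if_splits)
  have bottom: "measure_pmf.expectation (place_cards (rev [1..<Suc m]) (pile @ [Suc m]))
        (\<lambda>deck. real (correct_guesses (shelf_strategy n) deck)) =
      1 + real (correct_guesses (shelf_strategy_above (Suc m) n) pile)
        - of_bool (hd pile = Suc (Suc m)) + 3 * real m / 4 + (if m = 0 then 0 else 1 / 4)"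
    using Suc.prems set_new \<open>Suc m \<notin> set pile\<close> hds
    by (subst Suc.IH) (simp_all add: bottom_score)
  show ?case
    unfolding rev_upt expectation_place_cards_Cons top bottom
    by (simp add: field_simps)
qed

theorem theorem1p5:
  fixes n :: nat
  assumes "n \<ge> 2"
  shows "measure_pmf.expectation (shelf_shuffle n)
           (\<lambda>deck. real (correct_guesses (shelf_strategy n) deck)) = 3 * real n / 4"
proof -
  obtain m where n: "n = Suc m" "m \<noteq> 0"
    using assms by (cases n) auto
  have "rev [1..<Suc n] = n # rev [1..<Suc m]"
    using n by simp
  \<comment> \<open>On the empty pile both placements of card \<open>n\<close> give
    \<open>[n]\<close>, so its coin is irrelevant.\<close>
  then have "shelf_shuffle n = place_cards (rev [1..<Suc m]) [n]"
    by (simp add: shelf_shuffle_def cong: if_cong del: upt_Suc)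
  moreover have "{m<..n} = {n}"
    using n by auto
  moreover have "correct_guesses (shelf_strategy_above m n) [n] = 1"
    by (simp add: correct_guesses_eq_sum shelf_strategy_above_def n)
  ultimately show ?thesis
    \<comment> \<open>Card \<open>n - 1\<close> meets \<open>n\<close> on top, so the correction is
      \<open>- 1 / 4\<close> and the total is \<open>1 + 3 * (n - 1) / 4 - 1 / 4\<close>.\<close>
    using expectation_place_cards_shelf_strategy[of m n "[n]"] n by (simp add: field_simps)
qed

end
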